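(* Let $\delta=\sqrt{3/8}$ and let $\theta^u_{12},\theta^u_{23},\theta^d_{12},\theta^d_{23}\in(0,\pi/2)$ be given by $$\tan\theta^u_{12}=\frac{2/3-\delta}{2/3+\delta},\quad \tan\theta^u_{23}=\frac{2/3-\delta}{2/3},\quad \tan\theta^d_{12}=\frac{1-\delta}{1+\delta},\quad \sin\theta^d_{23}=\sin\theta_2\sin\theta_3,$$ where $\theta_2,\theta_3\in(0,\pi/2)$, $\tan\theta_2=\frac1{1+\delta}$, $\tan\theta_3=\frac{1-\delta}{1+\delta}$. For real $\varphi$ let $U_u=R_{23}(\theta^u_{23},0)R_{12}(\theta^u_{12},-\varphi)$, $U_d=R_{23}(\theta^d_{23},0)R_{12}(\theta^d_{12},0)$ and $V=U_u^\dagger U_d$, with rows labelled $u,c,t$ and columns $d,s,b$. Let $\sqrt{m_u}:\sqrt{m_c}=a^2b:abc$ with $(a,b,c)=(\tfrac23-\delta,\tfrac23,\tfrac23+\delta)$. Then, exactly, $$\frac{|V_{ub}|}{|V_{cb}|}=\tan\theta^u_{12}=\sqrt{\frac{m_u}{m_c}},$$ which is numerically $0.04245$ (rounded to five decimals).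
   Context: For $i<j$, $R_{ij}(\theta,\alpha)$ denotes the $3\times3$ unitary matrix equal to the identity except in rows and columns $i,j$, where it is $\begin{pmatrix}\cos\theta&e^{i\alpha}\sin\theta\\-e^{-i\alpha}\sin\theta&\cos\theta\end{pmatrix}$. This is the "minimal transport model": each sector's frame is the ordered product of a $(1,2)$ and a $(2,3)$ rotation, with a phase only on the $(1,2)$ blocks. *)

theory Defs
  imports "HOL-Analysis.Analysis"
begin

(* In the index type 3 the numeral 3 equals 0, so the order of that type is
   0 < 1 < 2; hence the rotation is defined from the pair (i, j) itself and
   not through a comparison of indices. It is meant for distinct i, j with i
   listed before j, i.e. (1,2), (1,3) and (2,3). *)
definition rot :: "3 \<Rightarrow> 3 \<Rightarrow> real \<Rightarrow> real \<Rightarrow> complex^3^3" where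
  "rot i j \<theta> \<alpha> = (\<chi> k l.
     if k = i \<and> l = i then of_real (cos \<theta>)
     else if k = i \<and> l = j then cis \<alpha> * of_real (sin \<theta>)
     else if k = j \<and> l = i then - cis (- \<alpha>) * of_real (sin \<theta>)
     else if k = j \<and> l = j then of_real (cos \<theta>)
     else if k = l then 1 else 0)"

definition ctranspose :: "complex^'n^'m \<Rightarrow> complex^'m^'n" where
  "ctranspose A = map_matrix cnj (transpose A)"

lemma rot_12:
  "rot 1 2 \<theta> \<alpha> = vector
     [vector [of_real (cos \<theta>), cis \<alpha> * of_real (sin \<theta>), 0],
      vector [- cis (- \<alpha>) * of_real (sin \<theta>), of_real (cos \<theta>), 0],
      vector [0, 0, 1]]"
  by (simp add: rot_def vec_eq_iff forall_3 vector_3)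

lemma rot_23:
  "rot 2 3 \<theta> \<alpha> = vector
     [vector [1, 0, 0],
      vector [0, of_real (cos \<theta>), cis \<alpha> * of_real (sin \<theta>)],
      vector [0, - cis (- \<alpha>) * of_real (sin \<theta>), of_real (cos \<theta>)]]"
  by (simp add: rot_def vec_eq_iff forall_3 vector_3)

(* Mixing matrices V have rows u, c, t at indices 1, 2, 3 and columns d, s, b
   at indices 1, 2, 3. *)
abbreviation V_ub :: "complex^3^3 \<Rightarrow> complex" where
  "V_ub V \<equiv> V $ 1 $ 3"

abbreviation V_cb :: "complex^3^3 \<Rightarrow> complex" where
  "V_cb V \<equiv> V $ 2 $ 3"

end

theory Submission
  imports Defs
begin

text \<open>
  The third column of \<open>U\<^sub>d\<close> does not see the \<open>(1,2)\<close> rotation, so \<open>V\<^sub>u\<^sub>b\<close> and \<open>V\<^sub>c\<^sub>b\<close> are, up to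
  phases, the sine and cosine of \<open>\<theta>\<^sup>u\<^sub>1\<^sub>2\<close> times the common factor \<open>sin (\<theta>\<^sup>u\<^sub>2\<^sub>3 - \<theta>\<^sup>d\<^sub>2\<^sub>3)\<close>, which
  cancels in the ratio. It is nonzero because \<open>sin\<^sup>2 \<theta>\<^sup>u\<^sub>2\<^sub>3 \<approx> 0.0066\<close> whereas
  \<open>sin\<^sup>2 \<theta>\<^sup>d\<^sub>2\<^sub>3 \<approx> 0.0152\<close>.
\<close>

text \<open>The phase-free (2,3) rotations combine into one by the angle difference; the adjoint
  (1,2) rotation of the up sector then splits its off-diagonal entry between rows u and c.\<close>

lemma transport_third_column:
  fixes \<theta>u12 \<theta>u23 \<theta>d12 \<theta>d23 \<phi> :: real
  defines "V \<equiv> ctranspose (rot 2 3 \<theta>u23 0 ** rot 1 2 \<theta>u12 (- \<phi>)) ** (rot 2 3 \<theta>d23 0 ** rot 1 2 \<theta>d12 0)"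
  shows V_ub_transport: "V_ub V = cis (- \<phi>) * of_real (sin \<theta>u12 * sin (\<theta>u23 - \<theta>d23))"
    and V_cb_transport: "V_cb V = - of_real (cos \<theta>u12 * sin (\<theta>u23 - \<theta>d23))"
  unfolding V_def
  by (simp_all add: rot_12 rot_23 ctranspose_def map_matrix_def transpose_def matrix_matrix_mult_def
      sum_3 vector_3 cis_cnj sin_diff algebra_simps)

text \<open>Bridges the angles given by tangents and \<open>\<theta>d23\<close>, given by sines;
  squaring avoids roots.\<close>

lemma sin_squared_tan:
  fixes x :: real
  assumes "cos x \<noteq> 0"
  shows "(sin x)\<^sup>2 = (tan x)\<^sup>2 / (1 + (tan x)\<^sup>2)"
proof -
  have "1 + (tan x)\<^sup>2 = 1 / (cos x)\<^sup>2"
    using tan_sec[OF assms] by (simp add: power_inverse divide_inverse)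
  then show ?thesis
    using assms by (simp add: tan_def power_divide)
qed

text \<open>Division by zero yields 0 in HOL, so \<open>V_cb V \<noteq> 0\<close> certifies a
  genuine ratio.\<close>

theorem lemma2:
  fixes \<delta> \<theta>u12 \<theta>u23 \<theta>d12 \<theta>d23 \<theta>2 \<theta>3 \<phi> a b c m_u m_c :: real
    and U_u U_d V :: "complex^3^3"
  assumes "\<delta> = sqrt (3/8)"
    and "\<theta>u12 \<in> {0<..<pi/2}" and "\<theta>u23 \<in> {0<..<pi/2}"
    and "\<theta>d12 \<in> {0<..<pi/2}" and "\<theta>d23 \<in> {0<..<pi/2}"
    and "\<theta>2 \<in> {0<..<pi/2}" and "\<theta>3 \<in> {0<..<pi/2}"
    and "tan \<theta>u12 = (2/3 - \<delta>) / (2/3 + \<delta>)"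
    and "tan \<theta>u23 = (2/3 - \<delta>) / (2/3)"
    and "tan \<theta>d12 = (1 - \<delta>) / (1 + \<delta>)"
    and "sin \<theta>d23 = sin \<theta>2 * sin \<theta>3"
    and "tan \<theta>2 = 1 / (1 + \<delta>)"
    and "tan \<theta>3 = (1 - \<delta>) / (1 + \<delta>)"
    and "U_u = rot 2 3 \<theta>u23 0 ** rot 1 2 \<theta>u12 (- \<phi>)"
    and "U_d = rot 2 3 \<theta>d23 0 ** rot 1 2 \<theta>d12 0"
    and "V = ctranspose U_u ** U_d"
    and "a = 2/3 - \<delta>" and "b = 2/3" and "c = 2/3 + \<delta>"
    and "m_u > 0" and "m_c > 0"
    and "sqrt m_u / sqrt m_c = (a^2 * b) / (a * b * c)"
  shows "V_cb V \<noteq> 0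
    \<and> norm (V_ub V) / norm (V_cb V) = tan \<theta>u12
    \<and> tan \<theta>u12 = sqrt (m_u / m_c)
    \<and> real_of_int (round (10^5 * (norm (V_ub V) / norm (V_cb V)))) / 10^5 = 0.04245"
proof -
  have sq: "\<delta>\<^sup>2 = 3/8" using assms(1) by simp
  \<comment> \<open>The final rounding dictates this precision; separating the angles needs far
    less.\<close>
  have \<delta>_lo: "0.61237 < \<delta>" unfolding assms(1) by (rule real_less_rsqrt) (simp add: power2_eq_square)
  have \<delta>_hi: "\<delta> < 0.612373" unfolding assms(1) by (rule real_less_lsqrt) (simp_all add: power2_eq_square)
  have cos_pos: "cos x > 0" if "x \<in> {0<..<pi/2}" for x :: real
    using that by (intro cos_gt_zero_pi) auto
  define s where "s = sin (\<theta>u23 - \<theta>d23)"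
  have ub: "V_ub V = cis (- \<phi>) * of_real (sin \<theta>u12 * s)"
    and cb: "V_cb V = - of_real (cos \<theta>u12 * s)"
    unfolding assms(14-16) s_def by (rule V_ub_transport V_cb_transport)+
  have "\<theta>u23 \<noteq> \<theta>d23"
  proof
    assume eq: "\<theta>u23 = \<theta>d23"
    have "(sin \<theta>d23)\<^sup>2 = (sin \<theta>2)\<^sup>2 * (sin \<theta>3)\<^sup>2"
      using assms(11) by (simp add: power_mult_distrib)
    also have "(sin \<theta>2)\<^sup>2 = 1 / (1 + (1 + \<delta>)\<^sup>2)"
      using \<delta>_lo cos_pos[OF assms(6)]
      by (subst sin_squared_tan) (auto simp: assms(12) power_divide divide_simps add_nonneg_eq_0_iff)
    also have "(sin \<theta>3)\<^sup>2 = (1 - \<delta>)\<^sup>2 / ((1 + \<delta>)\<^sup>2 + (1 - \<delta>)\<^sup>2)"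
      using \<delta>_lo cos_pos[OF assms(7)]
      by (subst sin_squared_tan) (auto simp: assms(13) power_divide divide_simps add_nonneg_eq_0_iff)
    also have "(1 + \<delta>)\<^sup>2 + (1 - \<delta>)\<^sup>2 = 11/4"
      using sq by (simp add: power2_eq_square algebra_simps)
    finally have d: "(sin \<theta>d23)\<^sup>2 = 1 / (1 + (1 + \<delta>)\<^sup>2) * ((1 - \<delta>)\<^sup>2 / (11/4))" .
    \<comment> \<open>The threshold 0.01 lies between the two squared sines. Here \<open>1/4\<close>
      comes from \<open>(1 + \<delta>)\<^sup>2 \<le> 3\<close> and 0.38 from
      \<open>0.38 \<le> 1 - \<delta>\<close>.\<close>
    have "0.01 < 1 / 4 * (0.38\<^sup>2 / (11/4) :: real)"
      by (simp add: power2_eq_square)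
    also have "\<dots> \<le> 1 / (1 + (1 + \<delta>)\<^sup>2) * ((1 - \<delta>)\<^sup>2 / (11/4))"
    proof (intro mult_mono divide_left_mono divide_right_mono power_mono)
      show "1 + (1 + \<delta>)\<^sup>2 \<le> 4"
        using sq \<delta>_hi by (simp add: power2_eq_square algebra_simps)
    qed (use \<delta>_lo \<delta>_hi in \<open>auto intro!: add_pos_nonneg\<close>)
    finally have "0.01 < (sin \<theta>u23)\<^sup>2"
      using d eq by simp
    also have "(sin \<theta>u23)\<^sup>2 = (tan \<theta>u23)\<^sup>2 / (1 + (tan \<theta>u23)\<^sup>2)"
      using cos_pos[OF assms(3)] by (intro sin_squared_tan) simp
    also have "\<dots> \<le> (tan \<theta>u23)\<^sup>2 / 1"
      by (intro divide_left_mono) (auto intro: add_pos_nonneg)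
    \<comment> \<open>\<open>tan \<theta>u23\<close> is about 0.081, so its square stays below the
      same threshold.\<close>
    also have "\<dots> \<le> 0.1\<^sup>2 / 1"
      using \<delta>_lo \<delta>_hi unfolding assms(9) by (intro divide_right_mono power_mono) auto
    finally show False by (simp add: power2_eq_square)
  qed
  \<comment> \<open>The difference lies strictly between \<open>-pi\<close> and \<open>pi\<close>,
    where sine vanishes only at 0.\<close>
  then have s: "s \<noteq> 0"
    using assms(3,5) sin_zero_pi_iff[of "\<theta>u23 - \<theta>d23"] by (auto simp: s_def abs_less_iff)
  have c0: "cos \<theta>u12 > 0" and s0: "sin \<theta>u12 > 0"
    using assms(2) cos_pos by (auto intro!: sin_gt_zero)
  have ratio: "norm (V_ub V) / norm (V_cb V) = tan \<theta>u12"
    using s c0 s0 by (simp add: ub cb norm_mult abs_mult tan_def)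
  \<comment> \<open>Cancelling \<open>a * b\<close> turns the mass ratio into
    \<open>a / c\<close>.\<close>
  have "a \<noteq> 0" "b \<noteq> 0"
    using \<delta>_hi by (simp_all add: assms(17,18))
  then have "tan \<theta>u12 = sqrt m_u / sqrt m_c"
    unfolding assms(22) assms(8) assms(17,19)[symmetric] by (simp add: power2_eq_square)
  then have mass: "tan \<theta>u12 = sqrt (m_u / m_c)"
    by (simp add: real_sqrt_divide)
  \<comment> \<open>The bounds on \<open>\<delta>\<close> place the tangent between 0.042448 and
    0.042452, within half a unit of the fifth decimal.\<close>
  have "round (10^5 * tan \<theta>u12) = 4245"
    using \<delta>_lo \<delta>_hi unfolding assms(8) by (intro round_unique') (simp add: field_simps abs_if)
  then show ?thesis
    using s c0 ratio mass by (simp add: cb)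
qed

end
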